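(* The following assertion (the SS--RS--GD conjecture) is false: "For every $n\ge 2$, $K\ge 1$ and $d\ge 1$ there exists a constant $\eta_{n,K}\in(0,1]$ such that, whenever real symmetric $d\times d$ matrices $A_1,\dots,A_n$ satisfy $(1-\eta_{n,K})I\preceq A_i\preceq I$ for all $i$, one has $\lVert W_{\mathrm{SS}}\rVert\le\lVert W_{\mathrm{RS}}\rVert\le\lVert W_{\mathrm{GD}}\rVert$." Concretely, fix $n=3$ and $K=2$. For every $\eta\in(0,1]$ there exist real symmetric positive definite $4\times 4$ matrices $A_1,A_2,A_3$ with $(1-\eta)I\preceq A_i\preceq I$ for $i=1,2,3$ such that $$\lVert W_{\mathrm{SS}}\rVert>\lVert W_{\mathrm{RS}}\rVert .$$
   Context: For real symmetric $d\times d$ matrices $A_1,\dots,A_n$, a permutation $\sigma\in\mathfrak{S}_n$ (the symmetric group on $\{1,\dots,n\}$) and an integer $K\ge1$, let $P_\sigma:=A_{\sigma(1)}A_{\sigma(2)}\cdots A_{\sigma(n)}$ and define $$W_{\mathrm{SS}}:=\frac1{n!}\sum_{\sigma\in\mathfrak{S}_n}P_\sigma^{K},\qquad W_{\mathrm{RS}}:=\Bigl(\frac1{n!}\sum_{\sigma\in\mathfrak{S}_n}P_\sigma\Bigr)^{K},\qquad W_{\mathrm{GD}}:=\Bigl(\frac1n\sum_{i=1}^nA_i\Bigr)^{nK}.$$ Here $I$ is the identity matrix, $\preceq$ is the Löwner order ($X\preceq Y$ iff $Y-X$ is positive semidefinite), and $\lVert\cdot\rVert$ is the spectral norm (largest singular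 value). *)

theory Defs
  imports
    Complex_Main
    "HOL-Combinatorics.Permutations"
    "Jordan_Normal_Form.Matrix"
    "Jordan_Normal_Form.Char_Poly"
begin

definition symmetric_mat :: "real mat \<Rightarrow> bool" where
  "symmetric_mat M \<longleftrightarrow> transpose_mat M = M"

definition pos_semidef :: "real mat \<Rightarrow> bool" where
  "pos_semidef M \<longleftrightarrow> symmetric_mat M \<and>
     (\<forall>v \<in> carrier_vec (dim_row M). 0 \<le> v \<bullet> (M *\<^sub>v v))"

definition pos_def :: "real mat \<Rightarrow> bool" where
  "pos_def M \<longleftrightarrow> symmetric_mat M \<and>
     (\<forall>v \<in> carrier_vec (dim_row M). v \<noteq> 0\<^sub>v (dim_row M) \<longrightarrow> 0 < v \<bullet> (M *\<^sub>v v))"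

(* The order \<open>\<le>\<close> that the library puts on matrices is entrywise, not the Loewner order. *)
definition loewner_le :: "real mat \<Rightarrow> real mat \<Rightarrow> bool" where
  "loewner_le X Y \<longleftrightarrow> pos_semidef (Y - X)"

definition singular_values :: "real mat \<Rightarrow> real set" where
  "singular_values M = {sqrt e | e. eigenvalue (transpose_mat M * M) e}"

(* The maximum is taken over a finite set, nonempty whenever M has at least one column. *)
definition spectral_norm :: "real mat \<Rightarrow> real" where
  "spectral_norm M = Max (singular_values M)"

(* Matrices of unspecified dimension do not form an additive monoid type, so \<open>sum\<close> is
   applied entrywise. *)
definition mat_sum :: "nat \<Rightarrow> ('i \<Rightarrow> real mat) \<Rightarrow> 'i set \<Rightarrow> real mat" where
  "mat_sum d F S = mat d d (\<lambda>(i, j). \<Sum>s\<in>S. F s $$ (i, j))"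

(* The ordered product A (\<sigma> 1) * A (\<sigma> 2) * ... * A (\<sigma> n) of d x d matrices. *)
definition perm_prod :: "nat \<Rightarrow> nat \<Rightarrow> (nat \<Rightarrow> real mat) \<Rightarrow> (nat \<Rightarrow> nat) \<Rightarrow> real mat" where
  "perm_prod d n A \<sigma> = foldr (*) (map (\<lambda>i. A (\<sigma> i)) [1..<Suc n]) (1\<^sub>m d)"

definition W_SS :: "nat \<Rightarrow> nat \<Rightarrow> nat \<Rightarrow> (nat \<Rightarrow> real mat) \<Rightarrow> real mat" where
  "W_SS d n K A =
     (1 / fact n) \<cdot>\<^sub>m mat_sum d (\<lambda>\<sigma>. perm_prod d n A \<sigma> ^\<^sub>m K) {\<sigma>. \<sigma> permutes {1..n}}"

definition W_RS :: "nat \<Rightarrow> nat \<Rightarrow> nat \<Rightarrow> (nat \<Rightarrow> real mat) \<Rightarrow> real mat" where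
  "W_RS d n K A =
     ((1 / fact n) \<cdot>\<^sub>m mat_sum d (perm_prod d n A) {\<sigma>. \<sigma> permutes {1..n}}) ^\<^sub>m K"

definition W_GD :: "nat \<Rightarrow> nat \<Rightarrow> nat \<Rightarrow> (nat \<Rightarrow> real mat) \<Rightarrow> real mat" where
  "W_GD d n K A = ((1 / real n) \<cdot>\<^sub>m mat_sum d A {1..n}) ^\<^sub>m (n * K)"

(* A 1, ..., A n are real symmetric d x d matrices between (1 - \<eta>) I and I;
   values of A outside {1..n} are irrelevant. *)
definition near_identity :: "nat \<Rightarrow> nat \<Rightarrow> real \<Rightarrow> (nat \<Rightarrow> real mat) \<Rightarrow> bool" where
  "near_identity d n \<eta> A \<longleftrightarrow>
     (\<forall>i\<in>{1..n}. A i \<in> carrier_mat d d \<and> symmetric_mat (A i) \<and>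
        loewner_le ((1 - \<eta>) \<cdot>\<^sub>m 1\<^sub>m d) (A i) \<and> loewner_le (A i) (1\<^sub>m d))"

(* \<eta> may depend on d here as well as on n and K. This is the weakest reading of the conjecture,
   so its negation also refutes the version in which \<eta> depends on n and K only. *)
definition SS_RS_GD_conjecture :: bool where
  "SS_RS_GD_conjecture \<longleftrightarrow>
     (\<forall>n K d. 2 \<le> n \<longrightarrow> 1 \<le> K \<longrightarrow> 1 \<le> d \<longrightarrow>
        (\<exists>\<eta>::real. 0 < \<eta> \<and> \<eta> \<le> 1 \<and>
           (\<forall>A. near_identity d n \<eta> A \<longrightarrow>
              spectral_norm (W_SS d n K A) \<le> spectral_norm (W_RS d n K A) \<and>
              spectral_norm (W_RS d n K A) \<le> spectral_norm (W_GD d n K A))))"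

end

theory Submission
  imports Defs
begin

text \<open>
  For an ordering \<open>\<sigma>\<close> write \<open>P\<^sub>\<sigma> = E + S\<^sub>\<sigma> + N\<^sub>\<sigma>\<close>, where \<open>E\<close> is the mean over all orderings and
  \<open>S\<^sub>\<sigma>\<close>, \<open>N\<^sub>\<sigma>\<close> are the symmetric and antisymmetric parts of the deviation. Then
  \<open>W\<^sub>S\<^sub>S - W\<^sub>R\<^sub>S\<close> is the mean of \<open>(S\<^sub>\<sigma> + N\<^sub>\<sigma>)\<^sup>2\<close>, whose quadratic form at \<open>v\<close> is the mean of
  \<open>|S\<^sub>\<sigma> v|\<^sup>2 - |N\<^sub>\<sigma> v|\<^sup>2\<close>. For \<open>A\<^sub>i\<close> within \<open>O(t)\<close> of the identity, \<open>N\<^sub>\<sigma>\<close> is generically of order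
  \<open>t\<^sup>2\<close> (commutators) and \<open>S\<^sub>\<sigma>\<close> of order \<open>t\<^sup>3\<close>, so \<open>\<parallel>W\<^sub>S\<^sub>S\<parallel> > \<parallel>W\<^sub>R\<^sub>S\<parallel>\<close> requires that the commutators
  almost annihilate the top eigenvector \<open>v\<close> of \<open>E\<close>. An \<open>S\<^sub>3\<close>-equivariant choice of the three matrices
  makes \<open>v = (1,1,1,0)\<close> an exact eigenvector of both averages; with the entries below the eigenvalue of
  \<open>W\<^sub>S\<^sub>S\<close> at \<open>v\<close> exceeds that of \<open>W\<^sub>R\<^sub>S\<close> by a multiple of \<open>3 t\<^sup>6 + O(t\<^sup>7)\<close>.
\<close>

section \<open>Arithmetic of block matrices\<close>

text \<open>A 3x3 block plus a scalar: this shape is closed under sums, products and transposes, so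
  all matrix identities become identities between ten scalars.\<close>

definition blk :: "real \<Rightarrow> real \<Rightarrow> real \<Rightarrow> real \<Rightarrow> real \<Rightarrow> real \<Rightarrow> real \<Rightarrow> real \<Rightarrow> real \<Rightarrow> real \<Rightarrow> real mat" where
  "blk a b c d e f g h i r = mat_of_rows_list 4 [[a,b,c,0],[d,e,f,0],[g,h,i,0],[0,0,0,r]]"

lemma less_4_cases: "(i::nat) < 4 \<longleftrightarrow> i = 0 \<or> i = 1 \<or> i = 2 \<or> i = 3"
  by auto

lemma blk_carrier [simp]: "blk a b c d e f g h i r \<in> carrier_mat 4 4"
  and blk_dim [simp]: "dim_row (blk a b c d e f g h i r) = 4" "dim_col (blk a b c d e f g h i r) = 4"
  by (auto simp: blk_def mat_of_rows_list_def)

lemma blk_index [simp]: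
  "blk a b c d e f g h i r $$ (0, 0) = a" "blk a b c d e f g h i r $$ (0, Suc 0) = b"
  "blk a b c d e f g h i r $$ (0, 2) = c" "blk a b c d e f g h i r $$ (0, 3) = 0"
  "blk a b c d e f g h i r $$ (Suc 0, 0) = d" "blk a b c d e f g h i r $$ (Suc 0, Suc 0) = e"
  "blk a b c d e f g h i r $$ (Suc 0, 2) = f" "blk a b c d e f g h i r $$ (Suc 0, 3) = 0"
  "blk a b c d e f g h i r $$ (2, 0) = g" "blk a b c d e f g h i r $$ (2, Suc 0) = h"
  "blk a b c d e f g h i r $$ (2, 2) = i" "blk a b c d e f g h i r $$ (2, 3) = 0"
  "blk a b c d e f g h i r $$ (3, 0) = 0" "blk a b c d e f g h i r $$ (3, Suc 0) = 0"
  "blk a b c d e f g h i r $$ (3, 2) = 0" "blk a b c d e f g h i r $$ (3, 3) = r"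
  by (simp_all add: blk_def mat_of_rows_list_def numeral_eq_Suc)

lemma sum_less_4: "(\<Sum>i\<in>{0..<4::nat}. f i) = f 0 + f 1 + f 2 + (f 3 :: real)"
  by (simp add: eval_nat_numeral)

lemma blk_cong:
  assumes "a = a'" "b = b'" "c = c'" "d = d'" "e = e'" "f = f'" "g = g'" "h = h'" "i = i'" "r = r'"
  shows "blk a b c d e f g h i r = blk a' b' c' d' e' f' g' h' i' r'"
  using assms by simp

lemma blk_eqI:
  assumes "M \<in> carrier_mat 4 4"
    and "\<And>i j. i < 4 \<Longrightarrow> j < 4 \<Longrightarrow> M $$ (i, j) = blk a b c d e f g h i' r $$ (i, j)"
  shows "M = blk a b c d e f g h i' r"
  using assms by (intro eq_matI) auto

lemma blk_one: "1\<^sub>m 4 = blk 1 0 0 0 1 0 0 0 1 1"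
  by (rule blk_eqI) (auto simp: less_4_cases)

lemma blk_transpose: "transpose_mat (blk a b c d e f g h i r) = blk a d g b e h c f i r"
  by (rule blk_eqI) (auto simp: less_4_cases)

lemma blk_smult: "k \<cdot>\<^sub>m blk a b c d e f g h i r = blk (k*a) (k*b) (k*c) (k*d) (k*e) (k*f) (k*g) (k*h) (k*i) (k*r)"
  by (rule blk_eqI) (auto simp: less_4_cases)

lemma blk_diff: "blk a b c d e f g h i r - blk a' b' c' d' e' f' g' h' i' r' =
   blk (a-a') (b-b') (c-c') (d-d') (e-e') (f-f') (g-g') (h-h') (i-i') (r-r')"
  by (rule blk_eqI) (auto simp: less_4_cases)

lemma blk_mult: "blk a b c d e f g h i r * blk a' b' c' d' e' f' g' h' i' r' =
   blk (a*a'+b*d'+c*g') (a*b'+b*e'+c*h') (a*c'+b*f'+c*i')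
       (d*a'+e*d'+f*g') (d*b'+e*e'+f*h') (d*c'+e*f'+f*i')
       (g*a'+h*d'+i*g') (g*b'+h*e'+i*h') (g*c'+h*f'+i*i') (r*r')"
  by (rule blk_eqI) (auto simp: less_4_cases scalar_prod_def sum_less_4)

section \<open>Sums over the six orderings\<close>

lemma sum_permutes_3:
  fixes F :: "(nat \<Rightarrow> nat) \<Rightarrow> real"
  assumes "\<And>\<sigma>. F \<sigma> = G (\<sigma> 1) (\<sigma> 2) (\<sigma> 3)"
  shows "(\<Sum>\<sigma> | \<sigma> permutes {1..3}. F \<sigma>) = G 1 2 3 + G 1 3 2 + G 2 1 3 + G 2 3 1 + G 3 1 2 + G 3 2 1"
proof -
  have "{1..3::nat} = {1, 2, 3}" by auto
  then show ?thesis
    by (simp add: sum_over_permutations_insert assms transpose_def)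
qed


lemma perm_prod_3:
  assumes "\<And>i. A i \<in> carrier_mat d d"
  shows "perm_prod d 3 A \<sigma> = A (\<sigma> 1) * (A (\<sigma> 2) * A (\<sigma> 3))"
  using right_mult_one_mat[OF assms] by (simp add: perm_prod_def upt_rec numeral_eq_Suc)

section \<open>Quadratic forms and spectra\<close>

lemma mult_vec_4_eq_iff:
  assumes "v \<in> carrier_vec 4" "w \<in> carrier_vec 4"
  shows "blk a b c d e f g h i r *\<^sub>v v = w \<longleftrightarrow>
    a * v $ 0 + b * v $ 1 + c * v $ 2 = w $ 0 \<and> d * v $ 0 + e * v $ 1 + f * v $ 2 = w $ 1 \<and>
    g * v $ 0 + h * v $ 1 + i * v $ 2 = w $ 2 \<and> r * v $ 3 = w $ 3"
  using assms
  by (auto simp: vec_eq_iff less_4_cases scalar_prod_def sum_less_4 all_conj_distrib)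

lemma quadratic_form_blk:
  assumes "v \<in> carrier_vec 4"
  shows "v \<bullet> (blk a b c d e f g h i r *\<^sub>v v) =
    v $ 0 * (a * v $ 0 + b * v $ 1 + c * v $ 2) + v $ 1 * (d * v $ 0 + e * v $ 1 + f * v $ 2) +
    v $ 2 * (g * v $ 0 + h * v $ 1 + i * v $ 2) + r * (v $ 3)\<^sup>2"
  using assms by (simp add: scalar_prod_def sum_less_4 power2_eq_square algebra_simps)

lemma pos_semidef_blk:
  assumes "\<And>x y z. 0 \<le> a*x\<^sup>2 + e*y\<^sup>2 + i*z\<^sup>2 + 2*b*x*y + 2*c*x*z + 2*f*y*z" and "0 \<le> r"
  shows "pos_semidef (blk a b c b e f c f i r)"
  unfolding pos_semidef_def
proof (intro conjI ballI)
  show "symmetric_mat (blk a b c b e f c f i r)"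
    by (simp add: symmetric_mat_def blk_transpose)
  fix v :: "real vec" assume v: "v \<in> carrier_vec (dim_row (blk a b c b e f c f i r))"
  have "0 \<le> r * (v $ 3)\<^sup>2" using assms(2) by simp
  then show "0 \<le> v \<bullet> (blk a b c b e f c f i r *\<^sub>v v)"
    using v assms(1)[of "v $ 0" "v $ 1" "v $ 2"]
    by (simp add: quadratic_form_blk power2_eq_square algebra_simps)
qed

text \<open>On the first three coordinates, \<open>J p q r\<close> is the general matrix commuting with all coordinate
  permutations.\<close>

abbreviation J :: "real \<Rightarrow> real \<Rightarrow> real \<Rightarrow> real mat" where
  "J p q r \<equiv> blk p q q q p q q q p r"

lemma J_square: "J p q r * J p q r = J (p*p + 2*q*q) (2*p*q + q*q) (r*r)"
  by (simp add: blk_mult algebra_simps)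

lemma eigenvalue_J_iff: "eigenvalue (J p q r) e \<longleftrightarrow> e = p + 2*q \<or> e = p - q \<or> e = r"
proof
  assume "eigenvalue (J p q r) e"
  then obtain v where v: "v \<in> carrier_vec 4" "v \<noteq> 0\<^sub>v 4" "J p q r *\<^sub>v v = e \<cdot>\<^sub>v v"
    by (auto simp: eigenvalue_def eigenvector_def)
  then have eq: "p * v $ 0 + q * v $ 1 + q * v $ 2 = e * v $ 0" "q * v $ 0 + p * v $ 1 + q * v $ 2 = e * v $ 1"
      "q * v $ 0 + q * v $ 1 + p * v $ 2 = e * v $ 2" "r * v $ 3 = e * v $ 3"
    by (auto simp: mult_vec_4_eq_iff)
  show "e = p + 2*q \<or> e = p - q \<or> e = r"
  proof (rule ccontr)
    assume ne: "\<not> ?thesis"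
    \<comment> \<open>The coordinate sum is scaled by \<open>p + 2*q\<close> and differences by
      \<open>p - q\<close>; if \<open>e\<close> avoids these values, all of them vanish.\<close>
    have "(p + 2*q - e) * (v $ 0 + v $ 1 + v $ 2) = 0" using eq(1-3) by (simp add: algebra_simps)
    moreover have "(p - q - e) * (v $ 0 - v $ 1) = 0" using eq(1,2) by (simp add: algebra_simps)
    moreover have "(p - q - e) * (v $ 1 - v $ 2) = 0" using eq(2,3) by (simp add: algebra_simps)
    moreover have "(r - e) * v $ 3 = 0" using eq(4) by (simp add: algebra_simps)
    ultimately have "v $ 0 + v $ 1 + v $ 2 = 0" "v $ 0 = v $ 1" "v $ 1 = v $ 2" "v $ 3 = 0"
      using ne by auto
    then have "v = 0\<^sub>v 4"
      using v(1) by (intro eq_vecI) (auto simp: less_4_cases)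
    with v(2) show False by simp
  qed
next
  have ev: "eigenvalue (J p q r) e" if "J p q r *\<^sub>v v = e \<cdot>\<^sub>v v" "v \<in> carrier_vec 4" "v $ i \<noteq> 0" "i < 4" for v e i
    using that by (auto simp: eigenvalue_def eigenvector_def intro!: exI[of _ v])
  assume "e = p + 2*q \<or> e = p - q \<or> e = r"
  moreover have "eigenvalue (J p q r) (p + 2*q)"
    by (rule ev[of "vec 4 (\<lambda>i. if i < 3 then 1 else 0)" _ 0])
      (simp_all add: mult_vec_4_eq_iff)
  moreover have "eigenvalue (J p q r) (p - q)"
    by (rule ev[of "vec 4 (\<lambda>i. if i = 0 then 1 else if i = 1 then -1 else 0)" _ 0])
      (simp_all add: mult_vec_4_eq_iff)
  moreover have "eigenvalue (J p q r) r"
    by (rule ev[of "vec 4 (\<lambda>i. if i = 3 then 1 else 0)" _ 3])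
      (simp_all add: mult_vec_4_eq_iff)
  ultimately show "eigenvalue (J p q r) e" by blast
qed

text \<open>\<open>J\<close> is symmetric and its square is again a \<open>J\<close>, whose
  eigenvalues are the squares of the original ones.\<close>

lemma spectral_norm_J: "spectral_norm (J p q r) = Max {\<bar>p + 2*q\<bar>, \<bar>p - q\<bar>, \<bar>r\<bar>}"
proof -
  have sq: "p*p + 2*q*q + 2*(2*p*q + q*q) = (p + 2*q)\<^sup>2" "p*p + 2*q*q - (2*p*q + q*q) = (p - q)\<^sup>2" "r*r = r\<^sup>2"
    by (simp_all add: power2_eq_square algebra_simps)
  have "singular_values (J p q r) = sqrt ` {(p + 2*q)\<^sup>2, (p - q)\<^sup>2, r\<^sup>2}"
    unfolding singular_values_def blk_transpose J_square eigenvalue_J_iff sq by blast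
  also have "\<dots> = {\<bar>p + 2*q\<bar>, \<bar>p - q\<bar>, \<bar>r\<bar>}" by simp
  finally show ?thesis by (simp add: spectral_norm_def)
qed

section \<open>The counterexample and its averages\<close>

text \<open>The three matrices are conjugate under permutation of the first three coordinates, which makes
  the averages over all orderings commute with \<open>S\<^sub>3\<close>. The entries come from \<open>k (I - t X)\<close> with
  \<open>X\<close> chosen so that the commutators of the \<open>X\<close>'s annihilate \<open>(1,1,1,0)\<close> to leading order in \<open>t\<close>,
  but not exactly: cancelling the antisymmetric part at the next order as well makes the two top
  eigenvalues of the mean agree up to order \<open>t\<^sup>2\<close>. The last diagonal entry is padding, and \<open>k\<close> scales
  the norms to at most 1.\<close>

definition witness :: "real \<Rightarrow> real \<Rightarrow> nat \<Rightarrow> real mat" where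
  "witness k t i =
     (let a = k * (1 + t\<^sup>2); b = k * t; c = - k * (2*t + t\<^sup>2); r = k * (1 - 4*t) in
      if i = 1 then blk k b b b a c b c a r
      else if i = 2 then blk a b c b k b c b a r
      else blk a c b c a b b b k r)"

lemma witness_carrier: "witness k t i \<in> carrier_mat 4 4"
  by (simp add: witness_def Let_def)

lemma blk_add: "blk a b c d e f g h i r + blk a' b' c' d' e' f' g' h' i' r' =
   blk (a+a') (b+b') (c+c') (d+d') (e+e') (f+f') (g+g') (h+h') (i+i') (r+r')"
  by (rule blk_eqI) (auto simp: less_4_cases)

lemma mat_sum_permutes_3:
  assumes "\<And>a b c. H a b c \<in> carrier_mat d d"
  shows "mat_sum d (\<lambda>\<sigma>. H (\<sigma> 1) (\<sigma> 2) (\<sigma> 3)) {\<sigma>. \<sigma> permutes {1..3}} =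
    H 1 2 3 + H 1 3 2 + H 2 1 3 + H 2 3 1 + H 3 1 2 + H 3 (2::nat) (1::nat)"
  (is "?S = ?H")
proof (rule eq_matI)
  have dims: "dim_row (H a b c) = d" "dim_col (H a b c) = d" for a b c using assms[of a b c] by auto
  then show "dim_row ?S = dim_row ?H" "dim_col ?S = dim_col ?H" by (auto simp: mat_sum_def)
  fix i j assume "i < dim_row ?H" "j < dim_col ?H"
  then show "?S $$ (i, j) = ?H $$ (i, j)"
    using sum_permutes_3[of "\<lambda>\<sigma>. H (\<sigma> 1) (\<sigma> 2) (\<sigma> 3) $$ (i, j)" "\<lambda>a b c. H a b c $$ (i, j)"]
    by (simp add: mat_sum_def dims)
qed

lemma witness_simps:
  "witness k t 1 = blk k (k*t) (k*t) (k*t) (k*(1+t^2)) (- k * (2*t + t\<^sup>2)) (k*t) (- k * (2*t + t\<^sup>2)) (k*(1+t^2)) (k * (1 - 4*t))"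
  "witness k t 2 = blk (k*(1+t^2)) (k*t) (- k * (2*t + t\<^sup>2)) (k*t) k (k*t) (- k * (2*t + t\<^sup>2)) (k*t) (k*(1+t^2)) (k * (1 - 4*t))"
  "witness k t 3 = blk (k*(1+t^2)) (- k * (2*t + t\<^sup>2)) (k*t) (- k * (2*t + t\<^sup>2)) (k*(1+t^2)) (k*t) (k*t) (k*t) k (k * (1 - 4*t))"
  by (simp_all add: witness_def Let_def)

text \<open>The six products are simultaneous row and column permutations of one matrix.\<close>

lemma perm_prod_witness:
  fixes k t :: real
  defines "r \<equiv> (k * (1 - 4*t))^3"
    and "x \<equiv> k^3 * (1 - 4*t^2 - 5*t^3 - t^5)"
    and "y \<equiv> k^3 * (1 - 4*t^2 - 14*t^3 - 18*t^4 - 10*t^5 - t^6)"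
    and "u \<equiv> k^3 * (- (t^2) + 2*t^3 + 4*t^4 + t^5)"
    and "w \<equiv> k^3 * (2*t^2 + 2*t^3 - t^4)"
    and "s \<equiv> k^3 * (2*t^2 + 5*t^3 + 5*t^4 + 6*t^5 + t^6)"
    and "z \<equiv> k^3 * (- (t^2) - 4*t^3 - 8*t^4 - 2*t^5 - t^6)"
  shows "witness k t 1 * (witness k t 2 * witness k t 3) = blk x u w s y u z s x r" 
    and "witness k t 1 * (witness k t 3 * witness k t 2) = blk x w u z x s s u y r"
    and "witness k t 2 * (witness k t 1 * witness k t 3) = blk y s u u x w s z x r"
    and "witness k t 2 * (witness k t 3 * witness k t 1) = blk x z s w x u u s y r"
    and "witness k t 3 * (witness k t 1 * witness k t 2) = blk y u s s x z u w x r"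
    and "witness k t 3 * (witness k t 2 * witness k t 1) = blk x s z u y s w u x r"
  unfolding witness_simps blk_mult assms
  apply (rule_tac [!] blk_cong)
  apply (simp_all add: algebra_simps eval_nat_numeral)
  done

text \<open>The diagonal entry carries \<open>- 2 * q\<close> so that \<open>q\<close> cancels in
  the eigenvalue at (1,1,1,0).\<close>

lemma mat_sum_witness:
  fixes k t :: real
  defines "q \<equiv> 3*t^2 + 12*t^3 + 9*t^4 + 12*t^5 + t^6"
  shows "mat_sum 4 (perm_prod 4 3 (witness k t)) {\<sigma>. \<sigma> permutes {1..3}} =
    J (k^3 * (6 - 18*t^2 - 24*t^3 - 18*t^4 - 2 * q)) (k^3 * q) (6 * (k * (1 - 4*t))^3)"
proof -
  have e: "perm_prod 4 3 (witness k t) = (\<lambda>\<sigma>. witness k t (\<sigma> 1) * (witness k t (\<sigma> 2) * witness k t (\<sigma> 3)))"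
    by (intro ext perm_prod_3 witness_carrier)
  show ?thesis
    unfolding e q_def
    apply (subst mat_sum_permutes_3)
     apply (intro mult_carrier_mat[of _ 4 4] witness_carrier)
    apply (unfold perm_prod_witness blk_add)
    apply (intro blk_cong)
    apply (simp_all add: algebra_simps)
    done
qed

text \<open>Only the eigenvalue at (1,1,1,0) matters, as a lower bound for the norm, so
  \<open>p\<close> and \<open>q\<close> stay unspecified. The terms after the square are the gain
  over \<open>W_RS\<close>.\<close>

lemma mat_sum_square_witness:
  fixes k t :: real
  obtains p q where "mat_sum 4 (\<lambda>\<sigma>. perm_prod 4 3 (witness k t) \<sigma> ^\<^sub>m 2) {\<sigma>. \<sigma> permutes {1..3}} =
      J p q (6 * (k * (1 - 4*t))^6)"
    "p + 2 * q = 6 * k^6 * ((1 - 3*t^2 - 4*t^3 - 3*t^4)^2 + 3*t^6 + 12*t^7 + 24*t^8 + 24*t^9 + 3*t^10)"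
proof -
  have sq: "M ^\<^sub>m 2 = M * M" if "M \<in> carrier_mat 4 4" for M :: "real mat"
    using that by (simp add: numeral_2_eq_2)
  have e: "(\<lambda>\<sigma>. perm_prod 4 3 (witness k t) \<sigma> ^\<^sub>m 2) =
     (\<lambda>\<sigma>. (witness k t (\<sigma> 1) * (witness k t (\<sigma> 2) * witness k t (\<sigma> 3))) *
         (witness k t (\<sigma> 1) * (witness k t (\<sigma> 2) * witness k t (\<sigma> 3))))"
    by (intro ext, subst perm_prod_3[OF witness_carrier], rule sq)
      (intro mult_carrier_mat[of _ 4 4] witness_carrier)
  define r x y u w s z where d: "r = (k * (1 - 4*t))^3"
    "x = k^3 * (1 - 4*t^2 - 5*t^3 - t^5)"
    "y = k^3 * (1 - 4*t^2 - 14*t^3 - 18*t^4 - 10*t^5 - t^6)"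
    "u = k^3 * (- (t^2) + 2*t^3 + 4*t^4 + t^5)"
    "w = k^3 * (2*t^2 + 2*t^3 - t^4)"
    "s = k^3 * (2*t^2 + 5*t^3 + 5*t^4 + 6*t^5 + t^6)"
    "z = k^3 * (- (t^2) - 4*t^3 - 8*t^4 - 2*t^5 - t^6)"
  \<comment> \<open>Diagonal and off-diagonal entries of the sum of the six squares. Keeping the
    letters opaque delays the expansion in \<open>t\<close> to a single identity.\<close>
  let ?p = "2 * (2*x^2 + y^2 + 4*u*s + 2*w*z)"
  let ?q = "2*x*(u+w+s+z) + 2*y*(u+s) + u^2 + s^2 + 2*u*z + 2*s*w"
  have "mat_sum 4 (\<lambda>\<sigma>. perm_prod 4 3 (witness k t) \<sigma> ^\<^sub>m 2) {\<sigma>. \<sigma> permutes {1..3}} = J ?p ?q (6 * r^2)"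
    unfolding e
    apply (subst mat_sum_permutes_3)
     apply (intro mult_carrier_mat[of _ 4 4] witness_carrier)
    apply (unfold perm_prod_witness d[symmetric] blk_add blk_mult)
    apply (intro blk_cong)
    apply (simp_all add: algebra_simps power2_eq_square)
    done
  moreover have "?p + 2 * ?q = 6 * k^6 * ((1 - 3*t^2 - 4*t^3 - 3*t^4)^2 + 3*t^6 + 12*t^7 + 24*t^8 + 24*t^9 + 3*t^10)"
    unfolding d by (simp add: algebra_simps eval_nat_numeral)
  ultimately show thesis using that d(1) by simp
qed

section \<open>Loewner bounds and definiteness\<close>

lemma witness_form_lower:
  fixes t :: real
  assumes "0 \<le> t"
  shows "(1 - 4*t) * (x\<^sup>2 + y\<^sup>2 + z\<^sup>2) \<le>
    x\<^sup>2 + (1 + t\<^sup>2) * (y\<^sup>2 + z\<^sup>2) + 2*t*x*y + 2*t*x*z - 2*(2*t + t\<^sup>2)*y*z"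
proof -
  \<comment> \<open>This is exactly the difference of the two sides.\<close>
  have "0 \<le> t * ((x + y)\<^sup>2 + (x + z)\<^sup>2 + y\<^sup>2 + z\<^sup>2 + 2*x\<^sup>2 + 2*(y - z)\<^sup>2) + t\<^sup>2 * (y - z)\<^sup>2"
    using assms by simp
  then show ?thesis by (simp add: power2_eq_square algebra_simps)
qed

lemma witness_form_upper:
  fixes t :: real
  assumes "0 \<le> t" "t \<le> 1"
  shows "x\<^sup>2 + (1 + t\<^sup>2) * (y\<^sup>2 + z\<^sup>2) + 2*t*x*y + 2*t*x*z - 2*(2*t + t\<^sup>2)*y*z \<le>
    (1 + 4*t) * (x\<^sup>2 + y\<^sup>2 + z\<^sup>2)"
proof -
  \<comment> \<open>The only quadratic term in \<open>t\<close> is made linear; the rest is then a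
    sum of squares.\<close>
  have "t\<^sup>2 * (y - z)\<^sup>2 \<le> t * (y - z)\<^sup>2"
    using assms by (intro mult_right_mono) (simp_all add: power2_eq_square mult_left_le)
  moreover have "0 \<le> t * ((y + z - x)\<^sup>2 + 2*(y + z)\<^sup>2 + 3*x\<^sup>2)"
    using assms by simp
  ultimately show ?thesis by (simp add: power2_eq_square algebra_simps)
qed

lemma witness_cases: "witness k t i = witness k t 1 \<or> witness k t i = witness k t 2 \<or> witness k t i = witness k t 3"
  by (simp add: witness_def Let_def)

lemma witness_lower:
  assumes "0 \<le> k" "0 \<le> t" "c \<le> k * (1 - 4*t)"
  shows "loewner_le (c \<cdot>\<^sub>m 1\<^sub>m 4) (witness k t i)"
proof -
  have *: "c * (x\<^sup>2 + y\<^sup>2 + z\<^sup>2) \<le> k * (x\<^sup>2 + (1 + t\<^sup>2) * (y\<^sup>2 + z\<^sup>2) + 2*t*x*y + 2*t*x*z - 2*(2*t + t\<^sup>2)*y*z)" for x y z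
    using mult_right_mono[OF assms(3), of "x\<^sup>2 + y\<^sup>2 + z\<^sup>2"] mult_left_mono[OF witness_form_lower[OF assms(2), of x y z] assms(1)]
    by (simp add: mult.assoc)
  have r: "0 \<le> k * (1 - 4*t) - c" using assms(3) by simp
  note blk = witness_simps blk_one blk_smult blk_diff mult_zero_right diff_zero
  have "pos_semidef (witness k t 1 - c \<cdot>\<^sub>m 1\<^sub>m 4)"
    unfolding blk
    apply (rule pos_semidef_blk)
    subgoal for x y z using *[of x y z] by (simp add: algebra_simps)
    using r by simp
  moreover have "pos_semidef (witness k t 2 - c \<cdot>\<^sub>m 1\<^sub>m 4)"
    unfolding blk
    apply (rule pos_semidef_blk)
    \<comment> \<open>By conjugacy the same form applies, with \<open>y\<close> now as the
      distinguished variable (and \<open>z\<close> for the third matrix).\<close>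
    subgoal for x y z using *[of y x z] by (simp add: algebra_simps)
    using r by simp
  moreover have "pos_semidef (witness k t 3 - c \<cdot>\<^sub>m 1\<^sub>m 4)"
    unfolding blk
    apply (rule pos_semidef_blk)
    subgoal for x y z using *[of z x y] by (simp add: algebra_simps)
    using r by simp
  ultimately show ?thesis
    using witness_cases[of k t i] unfolding loewner_le_def by metis
qed

lemma witness_upper:
  assumes "0 \<le> k" "0 \<le> t" "t \<le> 1" "k * (1 + 4*t) \<le> c"
  shows "loewner_le (witness k t i) (c \<cdot>\<^sub>m 1\<^sub>m 4)"
proof -
  have *: "k * (x\<^sup>2 + (1 + t\<^sup>2) * (y\<^sup>2 + z\<^sup>2) + 2*t*x*y + 2*t*x*z - 2*(2*t + t\<^sup>2)*y*z) \<le> c * (x\<^sup>2 + y\<^sup>2 + z\<^sup>2)" for x y z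
    using mult_right_mono[OF assms(4), of "x\<^sup>2 + y\<^sup>2 + z\<^sup>2"] mult_left_mono[OF witness_form_upper[OF assms(2,3), of x y z] assms(1)]
    by (simp add: mult.assoc)
  have r: "0 \<le> c - k * (1 - 4*t)" using assms(4) mult_nonneg_nonneg[OF assms(1,2)] by (simp add: algebra_simps)
  note blk = witness_simps blk_one blk_smult blk_diff mult_zero_right diff_0
  have "pos_semidef (c \<cdot>\<^sub>m 1\<^sub>m 4 - witness k t 1)"
    unfolding blk
    apply (rule pos_semidef_blk)
    subgoal for x y z using *[of x y z] by (simp add: algebra_simps)
    using r by simp
  moreover have "pos_semidef (c \<cdot>\<^sub>m 1\<^sub>m 4 - witness k t 2)"
    unfolding blk
    apply (rule pos_semidef_blk)
    subgoal for x y z using *[of y x z] by (simp add: algebra_simps)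
    using r by simp
  moreover have "pos_semidef (c \<cdot>\<^sub>m 1\<^sub>m 4 - witness k t 3)"
    unfolding blk
    apply (rule pos_semidef_blk)
    subgoal for x y z using *[of z x y] by (simp add: algebra_simps)
    using r by simp
  ultimately show ?thesis
    using witness_cases[of k t i] unfolding loewner_le_def by metis
qed

lemma witness_symmetric: "symmetric_mat (witness k t i)"
  using witness_cases[of k t i] by (auto simp: symmetric_mat_def witness_def Let_def blk_transpose)

lemma pos_def_of_loewner_le:
  assumes "loewner_le (c \<cdot>\<^sub>m 1\<^sub>m n) M" "0 < c" "M \<in> carrier_mat n n" "symmetric_mat M"
  shows "pos_def M"
  unfolding pos_def_def
proof (intro conjI ballI impI)
  fix v :: "real vec" assume v: "v \<in> carrier_vec (dim_row M)" "v \<noteq> 0\<^sub>v (dim_row M)"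
  then have vn: "v \<in> carrier_vec n" "v \<noteq> 0\<^sub>v n" using assms(3) by auto
  have "(c \<cdot>\<^sub>m 1\<^sub>m n) *\<^sub>v v = c \<cdot>\<^sub>v v"
    using vn by (intro eq_vecI) (auto simp: smult_scalar_prod_distrib[of _ n])
  then have "(M - c \<cdot>\<^sub>m 1\<^sub>m n) *\<^sub>v v = M *\<^sub>v v - c \<cdot>\<^sub>v v"
    using vn assms(3) by (subst minus_mult_distrib_mat_vec[of _ n n]) auto
  then have "v \<bullet> ((M - c \<cdot>\<^sub>m 1\<^sub>m n) *\<^sub>v v) = v \<bullet> (M *\<^sub>v v) - c * (v \<bullet> v)"
    using vn assms(3) by (simp add: scalar_prod_minus_distrib[of _ n])
  moreover have "0 \<le> v \<bullet> ((M - c \<cdot>\<^sub>m 1\<^sub>m n) *\<^sub>v v)"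
    using assms(1,3) vn by (auto simp: loewner_le_def pos_semidef_def)
  moreover have "0 < v \<bullet> v"
    using conjugate_square_greater_0_vec[OF vn(1)] vn(2) by (simp add: conjugate_vec_def)
  ultimately show "0 < v \<bullet> (M *\<^sub>v v)"
    using mult_pos_pos[OF assms(2), of "v \<bullet> v"] by linarith
qed (fact assms(4))

section \<open>Comparison of the two norms\<close>

lemma spectral_norm_W_RS_less_W_SS_witness:
  assumes k: "0 < k" and t: "0 < t" "t \<le> 1/100"
  shows "spectral_norm (W_RS 4 3 2 (witness k t)) < spectral_norm (W_SS 4 3 2 (witness k t))"
proof -
  define l where "l = 1 - 3*t^2 - 4*t^3 - 3*t^4"
  define q where "q = 3*t^2 + 12*t^3 + 9*t^4 + 12*t^5 + t^6"
  have six: "1 / fact 3 = (1/6::real)" by (simp add: fact_numeral)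
  \<comment> \<open>Bounding all higher powers by \<open>t / 100\<close> makes the polynomial
    estimates linear in \<open>t\<close>.\<close>
  have pow: "0 \<le> t^n" "t^Suc (Suc n) \<le> t / 100" for n
  proof -
    have "t * t^n \<le> t * 1" using t by (intro mult_left_mono power_le_one) auto
    then have "t * t^n \<le> 1/100" using t(2) by linarith
    then have "t * (t * t^n) \<le> t * (1/100)" using t by (intro mult_left_mono) auto
    then show "t^Suc (Suc n) \<le> t / 100" by simp
  qed (use t in simp)
  have p: "t^2 \<le> t/100" "t^3 \<le> t/100" "t^4 \<le> t/100" "t^5 \<le> t/100" "t^6 \<le> t/100"
    using pow(2)[of 0] pow(2)[of 1] pow(2)[of 2] pow(2)[of 3] pow(2)[of 4] by (simp_all add: eval_nat_numeral)
  have l: "1 - 4*t \<le> l" "9/10 \<le> l" using p t unfolding l_def by linarith+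
  have q: "0 \<le> q" "q \<le> 1" using p pow(1) t unfolding q_def by (simp, linarith)
  \<comment> \<open>The padding entry must not exceed the eigenvalue at (1,1,1,0).\<close>
  have "(1 - 4*t)^3 \<le> (1 - 4*t)^1" using t by (intro power_decreasing) auto
  then have r: "0 \<le> (1 - 4*t)^3" "(1 - 4*t)^3 \<le> l" using l t by auto

  have sq: "M ^\<^sub>m 2 = M * M" if "M \<in> carrier_mat 4 4" for M :: "real mat"
    using that by (simp add: numeral_2_eq_2)
  \<comment> \<open>Entries of the mean product; its eigenvalue at (1,1,1,0) is
    \<open>k^3 * l\<close>, which dominates the other two.\<close>
  define P Q R where "P = k^3 * l - k^3 * q / 3" "Q = k^3 * q / 6" "R = (k * (1 - 4*t))^3"
  have "W_RS 4 3 2 (witness k t) = J P Q R ^\<^sub>m 2"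
    unfolding W_RS_def mat_sum_witness blk_smult six
    by (intro arg_cong2[of _ _ _ _ "(^\<^sub>m)"] blk_cong refl) (simp_all add: P_Q_R_def l_def q_def algebra_simps)
  also have "\<dots> = J (P*P + 2*Q*Q) (2*P*Q + Q*Q) (R*R)"
    by (simp add: sq J_square)
  finally have "spectral_norm (W_RS 4 3 2 (witness k t)) = Max {\<bar>(P + 2*Q)\<^sup>2\<bar>, \<bar>(P - Q)\<^sup>2\<bar>, \<bar>R\<^sup>2\<bar>}"
    by (simp add: spectral_norm_J power2_eq_square algebra_simps)
  moreover have "P + 2*Q = k^3 * l" by (simp add: P_Q_R_def field_simps)
  moreover have "\<bar>P - Q\<bar> \<le> \<bar>k^3 * l\<bar>" 
  proof -
    \<comment> \<open>From \<open>l\<close> \<ge> 9/10 and 0 \<le> \<open>q\<close> \<le> 1, the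
      factor lies between 0 and \<open>l\<close>.\<close>
    have "P - Q = k^3 * (l - q/2)" by (simp add: P_Q_R_def algebra_simps)
    then show ?thesis using k l q by (simp add: abs_mult)
  qed
  moreover have "\<bar>R\<bar> \<le> \<bar>k^3 * l\<bar>"
    using k l r by (simp add: P_Q_R_def abs_mult power_mult_distrib)
  ultimately have "spectral_norm (W_RS 4 3 2 (witness k t)) \<le> (k^3 * l)\<^sup>2"
    by (simp add: abs_le_square_iff)
  also have "\<dots> = k^6 * l\<^sup>2" by (simp add: power_mult_distrib)
  also have "\<dots> < k^6 * (l\<^sup>2 + 3*t^6 + 12*t^7 + 24*t^8 + 24*t^9 + 3*t^10)"
    using k t by (intro mult_strict_left_mono) (simp_all add: add_pos_pos)
  also have "\<dots> \<le> spectral_norm (W_SS 4 3 2 (witness k t))"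
  proof -
    obtain p q where pq: "mat_sum 4 (\<lambda>\<sigma>. perm_prod 4 3 (witness k t) \<sigma> ^\<^sub>m 2) {\<sigma>. \<sigma> permutes {1..3}} =
        J p q (6 * (k * (1 - 4*t))^6)"
      "p + 2 * q = 6 * k^6 * (l^2 + 3*t^6 + 12*t^7 + 24*t^8 + 24*t^9 + 3*t^10)"
      using mat_sum_square_witness unfolding l_def by blast
    have "k^6 * (l\<^sup>2 + 3*t^6 + 12*t^7 + 24*t^8 + 24*t^9 + 3*t^10) = p/6 + 2*(q/6)"
      using pq(2) by (simp add: field_simps)
    also have "\<dots> \<le> \<bar>p/6 + 2*(q/6)\<bar>" by (rule abs_ge_self)
    also have "\<dots> \<le> spectral_norm (W_SS 4 3 2 (witness k t))"
      unfolding W_SS_def pq(1) six blk_smult spectral_norm_J by simp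
    finally show ?thesis .
  qed
  finally show ?thesis .
qed

section \<open>Choice of parameters and refutation\<close>

theorem theorem2:
  shows "\<not> SS_RS_GD_conjecture \<and>
    (\<forall>\<eta>::real. 0 < \<eta> \<and> \<eta> \<le> 1 \<longrightarrow>
      (\<exists>A :: nat \<Rightarrow> real mat.
         near_identity 4 3 \<eta> A \<and> (\<forall>i\<in>{1..3}. pos_def (A i)) \<and>
         spectral_norm (W_SS 4 3 2 A) > spectral_norm (W_RS 4 3 2 A)))"
proof -
  have main: "\<exists>A :: nat \<Rightarrow> real mat. near_identity 4 3 \<eta> A \<and> (\<forall>i\<in>{1..3}. pos_def (A i)) \<and>
      spectral_norm (W_SS 4 3 2 A) > spectral_norm (W_RS 4 3 2 A)" if \<eta>: "0 < \<eta>" "\<eta> \<le> 1" for \<eta> :: real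
  proof -
    \<comment> \<open>The spectra lie in [k(1-4t), k(1+4t)]; \<open>k\<close> makes the upper end 1,
      and \<open>t\<close> is small enough for the lower end to exceed 1-\<eta>.\<close>
    define t k where "t = \<eta> / 100" and "k = 1 / (1 + 4*t)"
    have t: "0 < t" "t \<le> 1/100" and k: "0 < k" "k * (1 + 4*t) \<le> 1"
      using \<eta> by (simp_all add: t_def k_def)
    have "(1 - \<eta>) * (1 + 4*t) \<le> 1 - 4*t"
      using \<eta> by (simp add: t_def algebra_simps)
    then have low: "1 - \<eta> \<le> k * (1 - 4*t)"
      using t by (simp add: k_def field_simps)
    have one: "1 \<cdot>\<^sub>m 1\<^sub>m 4 = (1\<^sub>m 4 :: real mat)" by auto
    have "near_identity 4 3 \<eta> (witness k t)"
      using witness_lower[OF _ _ low] witness_upper[OF _ _ _ k(2), unfolded one] k(1) t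
      by (auto simp: near_identity_def witness_carrier witness_symmetric)
    \<comment> \<open>The bound 1-\<eta> vanishes at \<eta> = 1, so positivity is taken from k(1-4t)
      > 0.\<close>
    moreover have "pos_def (witness k t i)" for i
      using k t by (intro pos_def_of_loewner_le[OF witness_lower[OF _ _ order_refl] _ witness_carrier witness_symmetric]) auto
    ultimately show ?thesis
      using spectral_norm_W_RS_less_W_SS_witness[OF k(1) t] by blast
  qed
  have "\<not> SS_RS_GD_conjecture"
  proof
    assume "SS_RS_GD_conjecture"
    then obtain \<eta> :: real where "0 < \<eta>" "\<eta> \<le> 1" and
      "\<And>A. near_identity 4 3 \<eta> A \<Longrightarrow> spectral_norm (W_SS 4 3 2 A) \<le> spectral_norm (W_RS 4 3 2 A)"
      unfolding SS_RS_GD_conjecture_def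
      by (elim allE[of _ 3] allE[of _ 2] allE[of _ 4]) auto
    with main show False by (meson not_le)
  qed
  with main show ?thesis by blast
qed

end
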